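(* Let $\sigma>0$, $\lambda>0$, $M\in\mathbb N$, $\vec k=(k_1,\dots,k_M)$ with all $k_j>0$. Define $g:X_c\to X_c$, $g(\vec x)=(g_j(\vec x))_{j=1}^M$, by $$g_j(\vec x)=\frac{\cosh(\sigma(\lambda+2E_j^-(\vec x)))-\cosh(\sigma(\lambda+2E_{j-1}^-(\vec x)))}{\sigma}.$$ Then $g$ is a (non-local) transformation between $\mathrm{BEP}(\vec k)$ and $\mathrm{ABEP}_{\mathsf L}(\sigma,\vec k,\lambda)$ in the following sense: for every $f\in C^3(X_c)$ and $\vec x\in X_c$, $$\big[L^{\mathrm{BEP}}_{\vec k}f\big](g(\vec x))=\big[L^{\mathrm{ABEP}_{\mathsf L}}_{\sigma,\vec k,\lambda}(f\circ g)\big](\vec x).$$ Consequently, if $\mathcal X(t)$ is an instance of $\mathrm{ABEP}_{\mathsf L}(\sigma,\vec k,\lambda)$ with $\mathcal X(0)=\vec x$, then the process $\mathcal Z(t)=g(\mathcal X(t))$ is an instance of $\mathrm{BEP}(\vec k)$ with initial position $\mathcal Z(0)=g(\vec x)$.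
   Context: $X_c=\mathbb R_{\ge0}^M$; $\sinh_\sigma(x)=\sinh(\sigma x)$, $\cosh_\sigma(x)=\cosh(\sigma x)$; $E_j^-(\vec x)=\sum_{i=1}^jx_i$, $E_0^-=0$. An "instance" of one of the following is a diffusion process on $X_c$ with the stated generator. $\mathrm{BEP}(\vec k)$ (Brownian energy process): $$[L^{\mathrm{BEP}}_{\vec k}f](\vec x)=\sum_{j=1}^{M-1}x_jx_{j+1}\Big(\frac{\partial}{\partial x_j}-\frac{\partial}{\partial x_{j+1}}\Big)^2f(\vec x)+(k_jx_{j+1}-k_{j+1}x_j)\Big(\frac{\partial}{\partial x_j}-\frac{\partial}{\partial x_{j+1}}\Big)f(\vec x).$$ $\mathrm{ABEP}_{\mathsf L}(\sigma,\vec k,\lambda)$ (dynamic ABEP, left version): $$[L^{\mathrm{ABEP}_{\mathsf L}}_{\sigma,\vec k,\lambda}f](\vec x)=\sum_{j=1}^{M-1}A_j\Big(\frac{\partial}{\partial x_j}-\frac{\partial}{\partial x_{j+1}}\Big)^2f(\vec x)+B_j\Big(\frac{\partial}{\partial x_j}-\frac{\partial}{\partial x_{j+1}}\Big)f(\vec x),$$ $$A_j=\frac1{\sigma^2}\sinh_\sigma(x_j)\sinh_\sigma(x_{j+1})\frac{\sinh_\sigma(\lambda+2E_j^--x_j)\sinh_\sigma(\lambda+2E_j^-+x_{j+1})}{\sinh_\sigma(\lambda+2E_j^-)^2},$$ $$B_j=\frac1\sigma\Big[k_j\sinh_\sigma(x_{j+1})\frac{\sinh_\sigma(\lambda+2E_j^-+x_{j+1})}{\sinh_\sigma(\lambda+2E_j^-)}-k_{j+1}\sinh_\sigma(x_j)\frac{\sinh_\sigma(\lambda+2E_j^--x_j)}{\sinh_\sigma(\lambda+2E_j^-)}$$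 $$-2\sinh_\sigma(x_j)\sinh_\sigma(x_{j+1})\frac{\cosh_\sigma(\lambda+2E_j^-)\sinh_\sigma(\lambda+2E_j^--x_j)\sinh_\sigma(\lambda+2E_j^-+x_{j+1})}{\sinh_\sigma(\lambda+2E_j^-)^3}\Big].$$ *)

theory Defs
  imports "HOL-Probability.Probability"
begin

text \<open>
  The sites \<open>1, \<dots>, M\<close> are the elements of an arbitrary finite linearly ordered type \<open>'m\<close>, so
  \<open>M = CARD('m)\<close>; up to renaming every \<open>M \<ge> 1\<close> arises in this way. The sites \<open>j\<close> with
  \<open>j \<le> M - 1\<close> are the elements of \<open>inner_sites\<close>, and \<open>next_site j\<close> is \<open>j + 1\<close>.
\<close>

definition inner_sites :: "'m::{finite,linorder} set" where
  "inner_sites = {j. \<exists>i. j < i}"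

definition next_site :: "'m::{finite,linorder} \<Rightarrow> 'm" where
  "next_site j = Min {i. j < i}"

text \<open>Configurations \<open>x \<in> \<real>\<^sup>M\<close>, i.e. \<open>real^'m\<close>.\<close>

type_synonym 'm config = "(real, 'm) vec"

definition Xc :: "'m::finite config set" where
  "Xc = {x. \<forall>j. 0 \<le> x $ j}"

subsection \<open>Differentiation on the closed orthant\<close>

text \<open>
  Derivatives are taken relative to \<open>Xc\<close>; they are unique, also at boundary points, where
  partial derivatives are one-sided.
\<close>

definition pderiv_Xc :: "'m::finite \<Rightarrow> ('m config \<Rightarrow> real) \<Rightarrow> 'm config \<Rightarrow> real" where
  "pderiv_Xc j f x = frechet_derivative f (at x within Xc) (axis j 1)"

primrec Ck_Xc :: "nat \<Rightarrow> ('m::finite config \<Rightarrow> real) \<Rightarrow> bool" where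
  "Ck_Xc 0 f \<longleftrightarrow> continuous_on Xc f"
| "Ck_Xc (Suc n) f \<longleftrightarrow>
     (\<forall>x\<in>Xc. f differentiable (at x within Xc)) \<and> (\<forall>j. Ck_Xc n (pderiv_Xc j f))"

text \<open>The operator \<open>\<partial>/\<partial>x\<^sub>j - \<partial>/\<partial>x\<^sub>j\<^sub>+\<^sub>1\<close>.\<close>

definition bond_deriv ::
  "'m::{finite,linorder} \<Rightarrow> ('m config \<Rightarrow> real) \<Rightarrow> 'm config \<Rightarrow> real" where
  "bond_deriv j f = (\<lambda>x. pderiv_Xc j f x - pderiv_Xc (next_site j) f x)"

subsection \<open>The generators\<close>

definition L_BEP ::
  "('m::{finite,linorder} \<Rightarrow> real) \<Rightarrow> ('m config \<Rightarrow> real) \<Rightarrow> 'm config \<Rightarrow> real" where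
  "L_BEP k f x =
     (\<Sum>j\<in>inner_sites.
        x $ j * x $ next_site j * bond_deriv j (bond_deriv j f) x
      + (k j * x $ next_site j - k (next_site j) * x $ j) * bond_deriv j f x)"

definition Em :: "'m::{finite,linorder} config \<Rightarrow> 'm \<Rightarrow> real" where
  "Em x j = (\<Sum>i\<in>{i. i \<le> j}. x $ i)"

text \<open>\<open>E\<^sup>-\<^sub>j\<^sub>-\<^sub>1\<close>; this is the empty sum for the first site.\<close>

definition Em_prev :: "'m::{finite,linorder} config \<Rightarrow> 'm \<Rightarrow> real" where
  "Em_prev x j = (\<Sum>i\<in>{i. i < j}. x $ i)"

definition ABEP_A ::
  "real \<Rightarrow> real \<Rightarrow> 'm::{finite,linorder} \<Rightarrow> 'm config \<Rightarrow> real" where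
  "ABEP_A \<sigma> lam j x =
    (let sh = (\<lambda>u. sinh (\<sigma> * u)); l = lam + 2 * Em x j; a = x $ j; b = x $ next_site j
     in 1 / \<sigma>^2 * sh a * sh b * (sh (l - a) * sh (l + b) / (sh l)^2))"

definition ABEP_B ::
  "real \<Rightarrow> ('m::{finite,linorder} \<Rightarrow> real) \<Rightarrow> real \<Rightarrow> 'm \<Rightarrow> 'm config \<Rightarrow> real" where
  "ABEP_B \<sigma> k lam j x =
    (let sh = (\<lambda>u. sinh (\<sigma> * u)); ch = (\<lambda>u. cosh (\<sigma> * u));
         l = lam + 2 * Em x j; a = x $ j; b = x $ next_site j
     in 1 / \<sigma> *
        (k j * sh b * (sh (l + b) / sh l)
         - k (next_site j) * sh a * (sh (l - a) / sh l)
         - 2 * sh a * sh b * (ch l * sh (l - a) * sh (l + b) / (sh l)^3)))"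

definition L_ABEP ::
  "real \<Rightarrow> ('m::{finite,linorder} \<Rightarrow> real) \<Rightarrow> real \<Rightarrow> ('m config \<Rightarrow> real) \<Rightarrow> 'm config \<Rightarrow> real" where
  "L_ABEP \<sigma> k lam f x =
     (\<Sum>j\<in>inner_sites.
        ABEP_A \<sigma> lam j x * bond_deriv j (bond_deriv j f) x
      + ABEP_B \<sigma> k lam j x * bond_deriv j f x)"

definition g_map :: "real \<Rightarrow> real \<Rightarrow> 'm::{finite,linorder} config \<Rightarrow> 'm config" where
  "g_map \<sigma> lam x =
     (\<chi> j. (cosh (\<sigma> * (lam + 2 * Em x j)) - cosh (\<sigma> * (lam + 2 * Em_prev x j))) / \<sigma>)"

subsection \<open>Diffusion processes with a given generator\<close>

abbreviation state_space :: "'m::finite config measure" where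
  "state_space \<equiv> restrict_space borel Xc"

definition C0_Xc :: "('m::finite config \<Rightarrow> real) \<Rightarrow> bool" where
  "C0_Xc f \<longleftrightarrow> continuous_on Xc f \<and> (f \<longlongrightarrow> 0) (inf at_infinity (principal Xc))"

text \<open>
  A (conservative) Feller semigroup on \<open>C\<^sub>0(Xc)\<close>, given by its transition kernels
  \<open>P t x\<close> for \<open>t \<ge> 0\<close> and \<open>x \<in> Xc\<close>; values outside this range are irrelevant.
\<close>

definition feller_semigroup :: "(real \<Rightarrow> 'm::finite config \<Rightarrow> 'm config measure) \<Rightarrow> bool" where
  "feller_semigroup P \<longleftrightarrow>
     (\<forall>t\<ge>0. P t \<in> state_space \<rightarrow>\<^sub>M prob_algebra state_space) \<and>
     (\<forall>x\<in>Xc. P 0 x = return state_space x) \<and>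
     (\<forall>s\<ge>0. \<forall>t\<ge>0. \<forall>x\<in>Xc. P (s + t) x = bind (P s x) (P t)) \<and>
     (\<forall>f. C0_Xc f \<longrightarrow>
        (\<forall>t\<ge>0. C0_Xc (\<lambda>x. \<integral>y. f y \<partial>P t x)) \<and>
        uniform_limit Xc (\<lambda>t x. \<integral>y. f y \<partial>P t x) f (at_right 0))"

text \<open>
  \<open>f\<close> lies in the domain of the infinitesimal generator of \<open>P\<close>, which maps it to \<open>h\<close>.
  Functions matter only through their values on \<open>Xc\<close>.
\<close>

definition inf_generator ::
  "(real \<Rightarrow> 'm::finite config \<Rightarrow> 'm config measure) \<Rightarrow> ('m config \<Rightarrow> real) \<Rightarrow> ('m config \<Rightarrow> real) \<Rightarrow> bool"
  where
  "inf_generator P f h \<longleftrightarrow> C0_Xc f \<and> C0_Xc h \<and>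
     uniform_limit Xc (\<lambda>t x. ((\<integral>y. f y \<partial>P t x) - f x) / t) h (at_right 0)"

definition natural_filtration :: "'w measure \<Rightarrow> (real \<Rightarrow> 'w \<Rightarrow> 'm::finite config) \<Rightarrow> real \<Rightarrow> 'w measure"
  where
  "natural_filtration W X t =
     sigma (space W) {X s -` A \<inter> space W |s A. 0 \<le> s \<and> s \<le> t \<and> A \<in> sets state_space}"

text \<open>
  \<open>X\<close>, defined on the probability space \<open>W\<close>, is a Markov process in \<open>Xc\<close> with continuous paths
  and a Feller transition semigroup whose infinitesimal generator is given by the differential
  operator \<open>L\<close> on \<open>C\<^sup>3\<close> functions with compact support. The test functions need not vanish at
  the boundary of \<open>Xc\<close>, so the boundary behaviour is prescribed as well.
\<close>

definition diffusion_with_generator ::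
  "(('m::finite config \<Rightarrow> real) \<Rightarrow> 'm config \<Rightarrow> real) \<Rightarrow> 'w measure \<Rightarrow> (real \<Rightarrow> 'w \<Rightarrow> 'm config) \<Rightarrow> bool"
  where
  "diffusion_with_generator L W X \<longleftrightarrow>
     prob_space W \<and>
     (\<forall>t\<ge>0. X t \<in> W \<rightarrow>\<^sub>M state_space) \<and>
     (\<forall>\<omega>\<in>space W. continuous_on {0..} (\<lambda>t. X t \<omega>)) \<and>
     (\<exists>P. feller_semigroup P \<and>
        (\<forall>f. Ck_Xc 3 f \<and> compact (closure {x\<in>Xc. f x \<noteq> 0}) \<longrightarrow> inf_generator P f (L f)) \<and>
        (\<forall>s\<ge>0. \<forall>t\<ge>0. \<forall>A\<in>sets state_space.
           AE \<omega> in W. real_cond_exp W (natural_filtration W X s)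
                          (\<lambda>\<omega>'. indicator A (X (s + t) \<omega>')) \<omega>
                        = measure (P t (X s \<omega>)) A))"

end

theory Submission
  imports Defs
begin

text \<open>
  In terms of partial sums, \<open>g\<close> acts coordinatewise: up to an additive constant it replaces each
  \<open>E\<^sub>j\<close> by \<open>cosh (\<sigma> (\<lambda> + 2 E\<^sub>j)) / \<sigma>\<close>. Since \<open>\<lambda> > 0\<close>, this is an increasing bijection of the
  half-line, so \<open>g\<close> is a homeomorphism of the orthant. The operator
  \<open>\<partial>/\<partial>x\<^sub>j - \<partial>/\<partial>x\<^sub>j\<^sub>+\<^sub>1\<close> is differentiation with respect to \<open>E\<^sub>j\<close>, which turns the
  intertwining of the generators into the one-dimensional chain rule and the factorisation
  \<open>cosh (p + q) - cosh (p - q) = 2 sinh p sinh q\<close> of the components of \<open>g\<close>. For the processes,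
  the Feller semigroup is pushed forward along \<open>g\<close>; composition with \<open>g\<close> preserves \<open>C\<^sub>0\<close>,
  \<open>C\<^sup>3\<close> and compact supports, and \<open>g\<close> being injective leaves the natural filtration unchanged.
\<close>

section \<open>Calculus on the closed orthant\<close>

text \<open>Uniqueness of a derivative within a set asks for points of the set arbitrarily close to
  \<open>x\<close> along each coordinate line. Positive steps never leave the orthant, so this works
  at boundary points as well.\<close>

lemma frechet_derivative_eq_Xc:
  assumes "(f has_derivative f') (at x within Xc)" "x \<in> Xc"
  shows "frechet_derivative f (at x within Xc) = f'"
proof (rule frechet_derivative_unique_within[OF _ assms(1)])
  show "(f has_derivative frechet_derivative f (at x within Xc)) (at x within Xc)"
    using assms(1) by (meson differentiableI frechet_derivative_works)
next
  fix i :: "'a config" and e :: real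
  assume i: "i \<in> Basis" and e: "e > 0"
  have "0 \<le> i $ j" for j
    using i by (auto simp: Basis_vec_def axis_def)
  then have "x + (e / 2) *\<^sub>R i \<in> Xc"
    using assms(2) e by (auto simp: Xc_def)
  then show "\<exists>d. 0 < \<bar>d\<bar> \<and> \<bar>d\<bar> < e \<and> x + d *\<^sub>R i \<in> Xc"
    using e by (intro exI[of _ "e / 2"]) auto
qed

lemma pderiv_Xc_eq:
  assumes "(f has_derivative f') (at x within Xc)" "x \<in> Xc"
  shows "pderiv_Xc j f x = f' (axis j 1)"
  using frechet_derivative_eq_Xc[OF assms] by (simp add: pderiv_Xc_def)

text \<open>By linearity of the derivative, the difference of two partials is a single directional
  derivative. All later chain rule arguments use this form.\<close>

lemma bond_deriv_eq:
  assumes "(f has_derivative f') (at x within Xc)" "x \<in> Xc"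
  shows "bond_deriv j f x = f' (axis j 1 - axis (next_site j) 1)"
  using has_derivative_linear[OF assms(1)]
  by (simp add: bond_deriv_def pderiv_Xc_eq[OF assms] linear_diff)

section \<open>Derivatives depend only on values on the orthant\<close>

lemma differentiable_cong_Xc:
  assumes "\<And>x. x \<in> Xc \<Longrightarrow> f x = h x" "x \<in> Xc" "h differentiable (at x within Xc)"
  shows "f differentiable (at x within Xc)"
  using assms has_derivative_transform unfolding differentiable_def by blast

lemma has_derivative_cong_Xc:
  assumes "\<And>x. x \<in> Xc \<Longrightarrow> f x = h x" "x \<in> Xc"
  shows "(f has_derivative D) (at x within Xc) \<longleftrightarrow> (h has_derivative D) (at x within Xc)"
  using has_derivative_transform[of x Xc f h D] has_derivative_transform[of x Xc h f D] assms
  by auto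

text \<open>Both functions have the same derivatives at \<open>x\<close>, so the choice inside
  \<open>frechet_derivative\<close> returns the same map, even where neither is
  differentiable.\<close>

lemma pderiv_Xc_cong:
  assumes "\<And>x. x \<in> Xc \<Longrightarrow> f x = h x" "x \<in> Xc"
  shows "pderiv_Xc j f x = pderiv_Xc j h x"
  using has_derivative_cong_Xc[OF assms] by (simp add: pderiv_Xc_def frechet_derivative_def)

lemma bond_deriv_cong:
  assumes "\<And>x. x \<in> Xc \<Longrightarrow> f x = h x" "x \<in> Xc"
  shows "bond_deriv j f x = bond_deriv j h x"
  using pderiv_Xc_cong[OF assms] by (simp add: bond_deriv_def)

lemma Ck_Xc_cong:
  assumes "\<And>x. x \<in> Xc \<Longrightarrow> f x = h x" "Ck_Xc n h"
  shows "Ck_Xc n f"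
  using assms
proof (induction n arbitrary: f h)
  case 0
  then show ?case using continuous_on_cong[of Xc Xc f h] by simp
next
  case (Suc n)
  have "Ck_Xc n (pderiv_Xc j f)" for j
    using Suc.IH[of "pderiv_Xc j f" "pderiv_Xc j h"] pderiv_Xc_cong[of f h] Suc.prems by auto
  then show ?case
    using Suc.prems differentiable_cong_Xc[of f h] by auto
qed

section \<open>Closure properties of the classes C^k on the orthant\<close>

lemma Ck_Xc_has_derivative:
  assumes "Ck_Xc (Suc n) f" "x \<in> Xc"
  shows "(f has_derivative frechet_derivative f (at x within Xc)) (at x within Xc)"
  using assms frechet_derivative_works by auto

lemma Ck_Xc_SucD: "Ck_Xc (Suc n) f \<Longrightarrow> Ck_Xc n f"
proof (induction n arbitrary: f)
  case 0
  then show ?case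
    by (simp add: differentiable_imp_continuous_within continuous_on_eq_continuous_within)
qed auto

lemma Ck_Xc_mono:
  assumes "m \<le> n" "Ck_Xc n f"
  shows "Ck_Xc m f"
  using assms by (induction n rule: dec_induct) (auto dest: Ck_Xc_SucD simp del: Ck_Xc.simps)

lemma Ck_Xc_continuous: "Ck_Xc n f \<Longrightarrow> continuous_on Xc f"
  using Ck_Xc_mono[of 0 n f] by simp

text \<open>Allows explicit derivatives in place of the chosen ones in \<open>pderiv_Xc\<close>; the
  two agree only on \<open>Xc\<close>, which \<open>Ck_Xc_cong\<close> accommodates.\<close>

lemma Ck_Xc_SucI:
  assumes "\<And>x. x \<in> Xc \<Longrightarrow> (f has_derivative f' x) (at x within Xc)"
    and "\<And>j. Ck_Xc n (\<lambda>x. f' x (axis j 1))"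
  shows "Ck_Xc (Suc n) f"
proof -
  have "Ck_Xc n (pderiv_Xc j f)" for j
    by (rule Ck_Xc_cong[OF _ assms(2)]) (rule pderiv_Xc_eq[OF assms(1)])
  then show ?thesis
    using assms(1) by (auto intro: differentiableI)
qed

lemma Ck_Xc_const: "Ck_Xc n (\<lambda>x. c)"
proof (induction n arbitrary: c)
  case (Suc n)
  show ?case
    by (rule Ck_Xc_SucI[where f' = "\<lambda>_ _. 0"]) (auto intro: Suc)
qed auto

lemma Ck_Xc_add:
  assumes "Ck_Xc n f" "Ck_Xc n h"
  shows "Ck_Xc n (\<lambda>x. f x + h x)"
  using assms
proof (induction n arbitrary: f h)
  case 0
  then show ?case by (auto intro: continuous_intros)
next
  case (Suc n)
  show ?case
  proof (rule Ck_Xc_SucI)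
    show "((\<lambda>x. f x + h x) has_derivative (\<lambda>v. frechet_derivative f (at x within Xc) v
        + frechet_derivative h (at x within Xc) v)) (at x within Xc)" if "x \<in> Xc" for x
      using Suc.prems that by (intro has_derivative_add Ck_Xc_has_derivative)
    show "Ck_Xc n (\<lambda>x. frechet_derivative f (at x within Xc) (axis j 1)
        + frechet_derivative h (at x within Xc) (axis j 1))" for j
      using Suc.IH[of "pderiv_Xc j f" "pderiv_Xc j h"] Suc.prems
      by (simp add: pderiv_Xc_def[abs_def])
  qed
qed

lemma Ck_Xc_mult:
  assumes "Ck_Xc n f" "Ck_Xc n h"
  shows "Ck_Xc n (\<lambda>x. f x * h x)"
  using assms
proof (induction n arbitrary: f h)
  case 0
  then show ?case by (auto intro: continuous_intros)
next
  case (Suc n)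
  show ?case
  proof (rule Ck_Xc_SucI)
    show "((\<lambda>x. f x * h x) has_derivative (\<lambda>v. f x * frechet_derivative h (at x within Xc) v
        + frechet_derivative f (at x within Xc) v * h x)) (at x within Xc)" if "x \<in> Xc" for x
      using Suc.prems that by (intro has_derivative_mult Ck_Xc_has_derivative)
    \<comment> \<open>The product rule leaves one factor undifferentiated, so the induction
      hypothesis is also applied to \<open>f\<close> and \<open>h\<close> themselves, one order
      lower.\<close>
    have "Ck_Xc n f" "Ck_Xc n h"
      using Suc.prems by (auto intro: Ck_Xc_SucD simp del: Ck_Xc.simps)
    then show "Ck_Xc n (\<lambda>x. f x * frechet_derivative h (at x within Xc) (axis j 1)
        + frechet_derivative f (at x within Xc) (axis j 1) * h x)" for j
      using Suc.IH[of f "pderiv_Xc j h"] Suc.IH[of "pderiv_Xc j f" h] Suc.prems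
      by (intro Ck_Xc_add) (simp_all add: pderiv_Xc_def[abs_def])
  qed
qed

lemma Ck_Xc_sum:
  assumes "finite I" "\<And>i. i \<in> I \<Longrightarrow> Ck_Xc n (f i)"
  shows "Ck_Xc n (\<lambda>x. \<Sum>i\<in>I. f i x)"
  using assms by (induction I rule: finite_induct) (auto intro: Ck_Xc_const Ck_Xc_add)

lemma has_derivative_vec_within:
  fixes g :: "'a::real_normed_vector \<Rightarrow> (real, 'm::finite) vec"
  assumes "\<And>i. ((\<lambda>x. g x $ i) has_derivative (\<lambda>v. g' v $ i)) (at x within S)"
  shows "(g has_derivative g') (at x within S)"
  using assms
  by (subst has_derivative_componentwise_within) (auto simp: Basis_vec_def inner_axis)

lemma has_derivative_compose_Xc:
  assumes "f differentiable (at (g x) within Xc)" "(g has_derivative g') (at x within Xc)"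
    and "g ` Xc \<subseteq> Xc"
  shows "((f \<circ> g) has_derivative (\<lambda>v. frechet_derivative f (at (g x) within Xc) (g' v)))
    (at x within Xc)"
proof -
  have "(f has_derivative frechet_derivative f (at (g x) within Xc)) (at (g x) within g ` Xc)"
    using assms(1,3) frechet_derivative_works has_derivative_subset by blast
  from diff_chain_within[OF assms(2) this] show ?thesis
    by (simp add: o_def)
qed

lemma linear_axis_expansion:
  fixes v :: "(real, 'm::finite) vec" and f :: "(real, 'm) vec \<Rightarrow> real"
  assumes "linear f"
  shows "f v = (\<Sum>i\<in>UNIV. v $ i * f (axis i 1))"
proof -
  have "f v = f (\<Sum>i\<in>UNIV. (v $ i) *\<^sub>R axis i 1)"
    by (simp add: basis_expansion flip: scalar_mult_eq_scaleR)
  then show ?thesis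
    by (simp add: linear_sum[OF assms] linear_scale[OF assms])
qed

text \<open>A partial derivative of \<open>f \<circ> g\<close> is a sum of products of partials of
  \<open>g\<close> with \<open>pderiv_Xc i f \<circ> g\<close>. The induction keeps \<open>g\<close>
  fixed and varies \<open>f\<close>, so that its hypothesis covers these compositions.\<close>

lemma Ck_Xc_compose:
  fixes g :: "'m::finite config \<Rightarrow> 'n::finite config"
  assumes "Ck_Xc n f" "\<And>i. Ck_Xc n (\<lambda>x. g x $ i)" "g ` Xc \<subseteq> Xc"
  shows "Ck_Xc n (f \<circ> g)"
  using assms
proof (induction n arbitrary: f)
  case 0
  have "continuous_on Xc g"
    using continuous_on_vec_lambda[of Xc "\<lambda>i x. g x $ i"] 0 by (auto simp: eta_contract_eq)
  moreover have "continuous_on (g ` Xc) f"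
    using 0 continuous_on_subset by auto
  ultimately show ?case
    using continuous_on_compose by simp
next
  case (Suc n)
  let ?g' = "\<lambda>x v. \<chi> i. frechet_derivative (\<lambda>x. g x $ i) (at x within Xc) v"
  let ?f' = "\<lambda>x. frechet_derivative f (at x within Xc)"
  show ?case
  proof (rule Ck_Xc_SucI)
    fix x :: "'m config" assume x: "x \<in> Xc"
    have "((\<lambda>x. g x $ i) has_derivative (\<lambda>v. ?g' x v $ i)) (at x within Xc)" for i
      using Ck_Xc_has_derivative[OF Suc.prems(2)[of i] x] by (simp add: eta_contract_eq)
    then have "(g has_derivative ?g' x) (at x within Xc)"
      by (rule has_derivative_vec_within)
    then show "((f \<circ> g) has_derivative (\<lambda>v. ?f' (g x) (?g' x v))) (at x within Xc)"
      using Suc.prems x by (intro has_derivative_compose_Xc) auto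
  next
    fix j :: 'm
    have "Ck_Xc n (\<lambda>x. \<Sum>i\<in>UNIV. pderiv_Xc j (\<lambda>x. g x $ i) x * (pderiv_Xc i f \<circ> g) x)"
    proof (intro Ck_Xc_sum Ck_Xc_mult)
      fix i
      have "\<And>i. Ck_Xc n (\<lambda>x. g x $ i)"
        using Suc.prems(2) Ck_Xc_SucD by blast
      then have "Ck_Xc n (pderiv_Xc i f \<circ> g)"
        using Suc.prems by (intro Suc.IH) auto
      then show "Ck_Xc n (\<lambda>x. (pderiv_Xc i f \<circ> g) x)"
        by (simp add: o_def)
      show "Ck_Xc n (\<lambda>x. pderiv_Xc j (\<lambda>x. g x $ i) x)"
        using Suc.prems(2) by (simp add: eta_contract_eq)
    qed auto
    moreover have "?f' (g x) (?g' x (axis j 1)) =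
      (\<Sum>i\<in>UNIV. pderiv_Xc j (\<lambda>x. g x $ i) x * (pderiv_Xc i f \<circ> g) x)" if "x \<in> Xc" for x
    proof -
      have "linear (?f' (g x))"
        using that Suc.prems Ck_Xc_has_derivative has_derivative_linear by blast
      from linear_axis_expansion[OF this, of "?g' x (axis j 1)"] show ?thesis
        by (simp add: pderiv_Xc_def)
    qed
    ultimately show "Ck_Xc n (\<lambda>x. ?f' (g x) (?g' x (axis j 1)))"
      by (rule Ck_Xc_cong[rotated])
  qed
qed

section \<open>Partial sums\<close>

lemma zero_mem_Xc: "0 \<in> Xc"
  by (simp add: Xc_def)

lemma closed_Xc: "closed (Xc :: 'm::finite config set)"
proof -
  have "(Xc :: 'm config set) = (\<Inter>j. {x. 0 \<le> x $ j})"
    by (auto simp: Xc_def)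
  moreover have "closed {x :: 'm config. 0 \<le> x $ j}" for j
    by (intro closed_Collect_le continuous_intros)
  ultimately show ?thesis by (metis closed_INT)
qed

lemma Em_nonneg: "x \<in> Xc \<Longrightarrow> 0 \<le> Em x j"
  by (auto simp: Em_def Xc_def intro: sum_nonneg)

lemma Em_prev_nonneg: "x \<in> Xc \<Longrightarrow> 0 \<le> Em_prev x j"
  by (auto simp: Em_prev_def Xc_def intro: sum_nonneg)

lemma Em_eq_Em_prev_add: "Em x j = Em_prev x j + x $ j"
proof -
  have "{i. i \<le> j} = insert j {i. i < j}" by auto
  then show ?thesis by (simp add: Em_def Em_prev_def)
qed

lemma bounded_linear_Em: "bounded_linear (\<lambda>x. Em x j)"
  unfolding Em_def by (intro bounded_linear_sum bounded_linear_vec_nth)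

lemma bounded_linear_Em_prev: "bounded_linear (\<lambda>x. Em_prev x j)"
  unfolding Em_prev_def by (intro bounded_linear_sum bounded_linear_vec_nth)

section \<open>Successor sites and the bond direction\<close>

lemma inner_sites_iff:
  assumes "j \<in> inner_sites"
  shows "next_site j \<le> i \<longleftrightarrow> j < i"
  using assms unfolding inner_sites_def next_site_def by (subst Min_le_iff) auto

lemma next_site_greater: "j \<in> inner_sites \<Longrightarrow> j < next_site j"
  using inner_sites_iff[of j "next_site j"] by simp

lemma less_next_site_iff: "j \<in> inner_sites \<Longrightarrow> i < next_site j \<longleftrightarrow> i \<le> j"
  using inner_sites_iff[of j i] by auto

lemma Em_prev_next_site: "j \<in> inner_sites \<Longrightarrow> Em_prev x (next_site j) = Em x j"
  by (simp add: Em_prev_def Em_def less_next_site_iff)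

text \<open>Moving mass from \<open>next_site j\<close> to \<open>j\<close> leaves every partial sum
  except the one at \<open>j\<close> unchanged: both unit vectors contribute, and cancel, once
  \<open>i\<close> reaches the successor.\<close>

lemma Em_bond:
  assumes "j \<in> inner_sites"
  shows "Em (axis j 1 - axis (next_site j) 1) i = (if i = j then 1 else 0)"
  using inner_sites_iff[OF assms, of i]
  by (auto simp: Em_def axis_def sum_subtractf)

lemma Em_prev_bond:
  assumes "j \<in> inner_sites"
  shows "Em_prev (axis j 1 - axis (next_site j) 1) i = (if i = next_site j then 1 else 0)"
  using less_next_site_iff[OF assms, of i] next_site_greater[OF assms]
  by (auto simp: Em_prev_def axis_def sum_subtractf)

section \<open>Maps acting coordinatewise on partial sums\<close>

text \<open>In the coordinates \<open>Em x j\<close> this map is \<phi> - \<phi> 0 in each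
  coordinate. Both \<open>g_map\<close> and its inverse have this form, so continuity, invariance of
  the orthant and invertibility reduce to one real variable.\<close>

definition sum_map :: "(real \<Rightarrow> real) \<Rightarrow> 'm::{finite,linorder} config \<Rightarrow> 'm config" where
  "sum_map \<phi> x = (\<chi> j. \<phi> (Em x j) - \<phi> (Em_prev x j))"

text \<open>A telescoping sum along the order of \<open>A\<close>. All inner sums are restricted to
  \<open>A\<close>, so that adding a new maximum leaves the earlier terms untouched and contributes
  one increment.\<close>

lemma sum_increments:
  fixes x :: "'m::linorder \<Rightarrow> real" and \<phi> :: "real \<Rightarrow> real"
  assumes "finite A"
  shows "(\<Sum>i\<in>A. \<phi> (sum x {l\<in>A. l \<le> i}) - \<phi> (sum x {l\<in>A. l < i})) = \<phi> (sum x A) - \<phi> 0"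
  using assms
proof (induction A rule: finite_linorder_max_induct)
  case (insert b A)
  have "{l \<in> insert b A. l \<le> i} = {l\<in>A. l \<le> i}" "{l \<in> insert b A. l < i} = {l\<in>A. l < i}"
    if "i \<in> A" for i
    using insert.hyps that by auto
  moreover have "{l \<in> insert b A. l \<le> b} = insert b A" "{l \<in> insert b A. l < b} = A"
    using insert.hyps by auto
  moreover have "b \<notin> A" using insert.hyps by auto
  ultimately show ?case
    using insert by simp
qed auto

lemma Em_sum_map: "Em (sum_map \<phi> x) j = \<phi> (Em x j) - \<phi> 0"
proof -
  \<comment> \<open>Inside the initial segment up to \<open>j\<close>, restricting to the segment
    does not change the partial sums.\<close>
  have "{l. l \<le> j \<and> l \<le> i} = {l. l \<le> i}" "{l. l \<le> j \<and> l < i} = {l. l < i}" if "i \<le> j" for i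
    using that by auto
  then show ?thesis
    using sum_increments[of "{i. i \<le> j}" \<phi> "($) x"]
    by (simp add: Em_def Em_prev_def sum_map_def)
qed

lemma Em_prev_sum_map: "Em_prev (sum_map \<phi> x) j = \<phi> (Em_prev x j) - \<phi> 0"
  using Em_sum_map[of \<phi> x j] Em_eq_Em_prev_add[of "sum_map \<phi> x" j] by (simp add: sum_map_def)

lemma sum_map_mem_Xc:
  assumes "mono_on {0..} \<phi>" "x \<in> Xc"
  shows "sum_map \<phi> x \<in> Xc"
proof -
  have "Em_prev x j \<le> Em x j" for j
    using assms(2) by (simp add: Em_eq_Em_prev_add Xc_def)
  then show ?thesis
    using assms Em_prev_nonneg[OF assms(2)] Em_nonneg[OF assms(2)]
    by (auto simp: Xc_def sum_map_def mono_on_def)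
qed

lemma continuous_on_sum_map:
  assumes "continuous_on {0..} \<phi>"
  shows "continuous_on Xc (sum_map \<phi>)"
  unfolding sum_map_def
  using Em_nonneg Em_prev_nonneg
  by (intro continuous_on_vec_lambda continuous_intros continuous_on_compose2[OF assms]
      bounded_linear.continuous_on[OF bounded_linear_Em]
      bounded_linear.continuous_on[OF bounded_linear_Em_prev]) auto

text \<open>Only differences of \<psi> enter \<open>sum_map\<close>, so the constant
  \<open>c\<close> cancels and \<psi> has to invert \<phi> - \<phi> 0 only up to a shift.\<close>

lemma sum_map_sum_map:
  assumes "x \<in> Xc" "\<And>u. u \<ge> 0 \<Longrightarrow> \<psi> (\<phi> u - \<phi> 0) = u + c"
  shows "sum_map \<psi> (sum_map \<phi> x) = x"
proof -
  have "sum_map \<psi> (sum_map \<phi> x) $ j = x $ j" for j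
    using assms Em_nonneg[OF assms(1), of j] Em_prev_nonneg[OF assms(1), of j]
    by (simp add: sum_map_def[of \<psi>] Em_sum_map Em_prev_sum_map)
      (simp add: Em_eq_Em_prev_add)
  then show ?thesis by (simp add: vec_eq_iff)
qed

lemma homeomorphism_sum_map:
  assumes "continuous_on {0..} \<phi>" "continuous_on {0..} \<psi>" "mono_on {0..} \<phi>" "mono_on {0..} \<psi>"
    and "\<And>u. u \<ge> 0 \<Longrightarrow> \<psi> (\<phi> u - \<phi> 0) = u + c" "\<And>u. u \<ge> 0 \<Longrightarrow> \<phi> (\<psi> u - \<psi> 0) = u + d"
  shows "homeomorphism Xc Xc (sum_map \<phi>) (sum_map \<psi>)"
  using assms
  by (intro homeomorphismI continuous_on_sum_map)
    (auto intro: sum_map_mem_Xc sum_map_sum_map[where c = c] sum_map_sum_map[where c = d])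

section \<open>The transformation\<close>

text \<open>Solving \<open>cosh (\<sigma> * (lam + 2 * u)) / \<sigma> - cosh (\<sigma> * lam) /
  \<sigma> = v\<close> for \<open>u\<close> gives this function up to the constant
  \<open>lam / 2\<close>, which \<open>sum_map\<close> ignores.\<close>

definition g_inv :: "real \<Rightarrow> real \<Rightarrow> 'm::{finite,linorder} config \<Rightarrow> 'm config" where
  "g_inv \<sigma> lam = sum_map (\<lambda>v. arcosh (\<sigma> * v + cosh (\<sigma> * lam)) / (2 * \<sigma>))"

lemma g_map_eq_sum_map: "g_map \<sigma> lam = sum_map (\<lambda>u. cosh (\<sigma> * (lam + 2 * u)) / \<sigma>)"
  by (simp add: fun_eq_iff g_map_def sum_map_def diff_divide_distrib)

lemma continuous_on_arcosh_real: "continuous_on {1..} (arcosh :: real \<Rightarrow> real)"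
proof -
  have "continuous_on {1..} (\<lambda>x::real. ln (x + sqrt (x\<^sup>2 - 1)))"
  proof (intro continuous_intros ballI)
    fix x :: real assume "x \<in> {1..}"
    then have "x > 0" "sqrt (x\<^sup>2 - 1) \<ge> 0" by (auto simp: one_le_power)
    then show "x + sqrt (x\<^sup>2 - 1) \<noteq> 0" by linarith
  qed
  then show ?thesis
    by (subst continuous_on_cong[OF refl arcosh_real_def]) auto
qed

lemma homeomorphism_g_map:
  assumes "\<sigma> > 0" "lam > 0"
  shows "homeomorphism Xc Xc (g_map \<sigma> lam) (g_inv \<sigma> lam)"
proof -
  have ge1: "1 \<le> \<sigma> * v + cosh (\<sigma> * lam)" if "v \<ge> 0" for v
    using that assms cosh_real_ge_1[of "\<sigma> * lam"] by (simp add: add_increasing)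
  have nn: "0 \<le> \<sigma> * (lam + 2 * u)" if "u \<ge> 0" for u
    using that assms by simp
  show ?thesis
    unfolding g_map_eq_sum_map g_inv_def
  \<comment> \<open>Each shift is the value at 0 of the outer function:
    \<open>arcosh (cosh (\<sigma> * lam)) / (2 * \<sigma>)\<close> is \<open>lam / 2\<close>, and
    \<open>cosh (\<sigma> * lam) / \<sigma>\<close> is the value of the other one.\<close>
  proof (rule homeomorphism_sum_map[where c = "lam / 2" and d = "cosh (\<sigma> * lam) / \<sigma>"])
    show "continuous_on {0..} (\<lambda>u. cosh (\<sigma> * (lam + 2 * u)) / \<sigma>)"
      using assms by (intro continuous_intros) auto
    show "continuous_on {0..} (\<lambda>v. arcosh (\<sigma> * v + cosh (\<sigma> * lam)) / (2 * \<sigma>))"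
      using assms ge1
      by (intro continuous_intros continuous_on_compose2[OF continuous_on_arcosh_real]) auto
    show "mono_on {0..} (\<lambda>u. cosh (\<sigma> * (lam + 2 * u)) / \<sigma>)"
      using assms by (intro mono_onI divide_right_mono) (auto simp: cosh_real_nonneg_le_iff nn)
    show "mono_on {0..} (\<lambda>v. arcosh (\<sigma> * v + cosh (\<sigma> * lam)) / (2 * \<sigma>))"
    proof (intro mono_onI divide_right_mono)
      fix v w :: real assume "v \<in> {0..}" "w \<in> {0..}" "v \<le> w"
      then show "arcosh (\<sigma> * v + cosh (\<sigma> * lam)) \<le> arcosh (\<sigma> * w + cosh (\<sigma> * lam))"
        using assms ge1 by (subst cosh_real_nonneg_le_iff[symmetric]) auto
    qed (use assms in auto)
  next
    fix u :: real assume "u \<ge> 0"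
    then show "arcosh (\<sigma> * (cosh (\<sigma> * (lam + 2 * u)) / \<sigma> - cosh (\<sigma> * (lam + 2 * 0)) / \<sigma>)
        + cosh (\<sigma> * lam)) / (2 * \<sigma>) = u + lam / 2"
      using assms nn[of u] by (simp add: right_diff_distrib arcosh_cosh_real field_simps)
  next
    fix v :: real assume "v \<ge> 0"
    define w where "w = arcosh (\<sigma> * v + cosh (\<sigma> * lam))"
    have "arcosh (\<sigma> * 0 + cosh (\<sigma> * lam)) = \<sigma> * lam"
      using assms by (simp add: arcosh_cosh_real)
    moreover have "\<sigma> * (lam + 2 * (w / (2 * \<sigma>) - \<sigma> * lam / (2 * \<sigma>))) = w"
      using assms by (simp add: field_simps)
    moreover have "cosh w = \<sigma> * v + cosh (\<sigma> * lam)"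
      using ge1[OF \<open>v \<ge> 0\<close>] by (simp add: w_def)
    ultimately show "cosh (\<sigma> * (lam + 2 * (arcosh (\<sigma> * v + cosh (\<sigma> * lam)) / (2 * \<sigma>)
        - arcosh (\<sigma> * 0 + cosh (\<sigma> * lam)) / (2 * \<sigma>)))) / \<sigma> = v + cosh (\<sigma> * lam) / \<sigma>"
      using assms by (simp add: w_def[symmetric] add_divide_distrib)
  qed
qed

section \<open>Smoothness and derivative of the transformation\<close>

lemma Ck_Xc_cosh_sinh_affine:
  fixes l :: "'m::finite config \<Rightarrow> real"
  assumes "bounded_linear l"
  shows "Ck_Xc n (\<lambda>x. cosh (a + l x))" "Ck_Xc n (\<lambda>x. sinh (a + l x))"
\<comment> \<open>The two claims are proved together, since each function is, up to a constant
  factor, the partial derivative of the other.\<close>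
proof (induction n)
  case 0
  {
    case 1
    show ?case by (auto intro!: continuous_intros bounded_linear.continuous_on[OF assms])
  next
    case 2
    show ?case by (auto intro!: continuous_intros bounded_linear.continuous_on[OF assms])
  }
next
  case (Suc n)
  have l: "((\<lambda>x. a + l x) has_derivative l) (at x within Xc)" for x
    by (auto intro!: derivative_eq_intros bounded_linear_imp_has_derivative[OF assms])
  have c: "((\<lambda>x. cosh (a + l x)) has_derivative (\<lambda>v. sinh (a + l x) * l v)) (at x within Xc)" for x
    by (rule has_derivative_compose[OF l])
      (auto intro!: has_field_derivative_imp_has_derivative derivative_eq_intros)
  have s: "((\<lambda>x. sinh (a + l x)) has_derivative (\<lambda>v. cosh (a + l x) * l v)) (at x within Xc)" for x
    by (rule has_derivative_compose[OF l])
      (auto intro!: has_field_derivative_imp_has_derivative derivative_eq_intros)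
  {
    case 1
    show ?case
      by (rule Ck_Xc_SucI[OF c]) (auto intro!: Ck_Xc_mult Suc Ck_Xc_const)
  next
    case 2
    show ?case
      by (rule Ck_Xc_SucI[OF s]) (auto intro!: Ck_Xc_mult Suc Ck_Xc_const)
  }
qed

lemma Ck_Xc_g_map: "Ck_Xc n (\<lambda>x. g_map \<sigma> lam x $ i)"
proof -
  have "Ck_Xc n (\<lambda>x. cosh (\<sigma> * lam + 2 * \<sigma> * Em x i) * (1 / \<sigma>)
      + cosh (\<sigma> * lam + 2 * \<sigma> * Em_prev x i) * (- 1 / \<sigma>))"
    by (intro Ck_Xc_add Ck_Xc_mult Ck_Xc_const Ck_Xc_cosh_sinh_affine
      bounded_linear_const_mult bounded_linear_Em bounded_linear_Em_prev)
  then show ?thesis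
    by (simp add: g_map_def diff_divide_distrib algebra_simps)
qed

lemma has_derivative_cosh_Em:
  "((\<lambda>x. cosh (\<sigma> * (lam + 2 * Em x i))) has_derivative
     (\<lambda>v. 2 * \<sigma> * sinh (\<sigma> * (lam + 2 * Em x i)) * Em v i)) (at x within S)"
  "((\<lambda>x. cosh (\<sigma> * (lam + 2 * Em_prev x i))) has_derivative
     (\<lambda>v. 2 * \<sigma> * sinh (\<sigma> * (lam + 2 * Em_prev x i)) * Em_prev v i)) (at x within S)"
  "((\<lambda>x. sinh (\<sigma> * (lam + 2 * Em x i))) has_derivative
     (\<lambda>v. 2 * \<sigma> * cosh (\<sigma> * (lam + 2 * Em x i)) * Em v i)) (at x within S)"
proof -
  have c: "((\<lambda>u. cosh (\<sigma> * (lam + 2 * u))) has_derivative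
      (*) (2 * \<sigma> * sinh (\<sigma> * (lam + 2 * u)))) (at u)" for u :: real
    by (rule has_field_derivative_imp_has_derivative) (auto intro!: derivative_eq_intros)
  have s: "((\<lambda>u. sinh (\<sigma> * (lam + 2 * u))) has_derivative
      (*) (2 * \<sigma> * cosh (\<sigma> * (lam + 2 * u)))) (at u)" for u :: real
    by (rule has_field_derivative_imp_has_derivative) (auto intro!: derivative_eq_intros)
  note E = bounded_linear_imp_has_derivative[OF bounded_linear_Em]
  note E' = bounded_linear_imp_has_derivative[OF bounded_linear_Em_prev]
  show "((\<lambda>x. cosh (\<sigma> * (lam + 2 * Em x i))) has_derivative
     (\<lambda>v. 2 * \<sigma> * sinh (\<sigma> * (lam + 2 * Em x i)) * Em v i)) (at x within S)"
    using has_derivative_compose[OF E c] .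
  show "((\<lambda>x. cosh (\<sigma> * (lam + 2 * Em_prev x i))) has_derivative
     (\<lambda>v. 2 * \<sigma> * sinh (\<sigma> * (lam + 2 * Em_prev x i)) * Em_prev v i)) (at x within S)"
    using has_derivative_compose[OF E' c] .
  show "((\<lambda>x. sinh (\<sigma> * (lam + 2 * Em x i))) has_derivative
     (\<lambda>v. 2 * \<sigma> * cosh (\<sigma> * (lam + 2 * Em x i)) * Em v i)) (at x within S)"
    using has_derivative_compose[OF E s] .
qed

lemma has_derivative_g_map:
  assumes "\<sigma> \<noteq> 0"
  shows "(g_map \<sigma> lam has_derivative
     (\<lambda>v. \<chi> i. 2 * sinh (\<sigma> * (lam + 2 * Em x i)) * Em v i
            - 2 * sinh (\<sigma> * (lam + 2 * Em_prev x i)) * Em_prev v i)) (at x within S)"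
proof (rule has_derivative_vec_within)
  fix i
  have "((\<lambda>x. (cosh (\<sigma> * (lam + 2 * Em x i)) - cosh (\<sigma> * (lam + 2 * Em_prev x i))) / \<sigma>)
      has_derivative (\<lambda>v. (2 * \<sigma> * sinh (\<sigma> * (lam + 2 * Em x i)) * Em v i
         - 2 * \<sigma> * sinh (\<sigma> * (lam + 2 * Em_prev x i)) * Em_prev v i) / \<sigma>)) (at x within S)"
    by (intro bounded_linear.has_derivative[OF bounded_linear_divide] has_derivative_diff
        has_derivative_cosh_Em)
  then show "((\<lambda>x. g_map \<sigma> lam x $ i) has_derivative
      (\<lambda>v. (\<chi> i. 2 * sinh (\<sigma> * (lam + 2 * Em x i)) * Em v i
            - 2 * sinh (\<sigma> * (lam + 2 * Em_prev x i)) * Em_prev v i) $ i)) (at x within S)"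
    using assms by (simp add: g_map_def diff_divide_distrib mult.assoc)
qed

section \<open>Bond derivatives of compositions with the transformation\<close>

lemma bond_deriv_mult:
  assumes "f differentiable (at x within Xc)" "h differentiable (at x within Xc)" "x \<in> Xc"
  shows "bond_deriv j (\<lambda>x. f x * h x) x = f x * bond_deriv j h x + bond_deriv j f x * h x"
proof -
  obtain f' h' where d: "(f has_derivative f') (at x within Xc)" "(h has_derivative h') (at x within Xc)"
    using assms by (auto simp: differentiable_def)
  show ?thesis
    using bond_deriv_eq[OF has_derivative_mult[OF d] assms(3)]
      bond_deriv_eq[OF d(1) assms(3)] bond_deriv_eq[OF d(2) assms(3)] by simp
qed

text \<open>
  The bond operator is the derivative with respect to the partial sum \<open>Em x j\<close> when all other
  partial sums are fixed, which is why \<open>g_map\<close> acts on it by a scalar factor.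
\<close>

lemma bond_deriv_compose_g_map:
  assumes "\<sigma> > 0" "lam > 0" "x \<in> Xc" "j \<in> inner_sites"
    and "f differentiable (at (g_map \<sigma> lam x) within Xc)"
  shows "bond_deriv j (f \<circ> g_map \<sigma> lam) x =
    2 * sinh (\<sigma> * (lam + 2 * Em x j)) * bond_deriv j f (g_map \<sigma> lam x)"
proof -
  let ?g = "g_map \<sigma> lam"
  have image: "?g ` Xc \<subseteq> Xc"
    using homeomorphism_g_map[OF assms(1,2)] homeomorphism_image1 by blast
  let ?v = "axis j 1 - axis (next_site j) 1 :: 'a config"
  let ?s = "2 * sinh (\<sigma> * (lam + 2 * Em x j))"
  let ?f' = "frechet_derivative f (at (?g x) within Xc)"
  have f': "(f has_derivative ?f') (at (?g x) within Xc)"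
    using assms(5) frechet_derivative_works by blast
  have "j \<noteq> next_site j"
    using next_site_greater[OF assms(4)] by simp
  \<comment> \<open>Only \<open>i = j\<close> and \<open>i = next_site j\<close> give nonzero terms.
    At the latter, \<open>Em_prev\<close> equals \<open>Em x j\<close>, so the same factor appears
    with the opposite sign and the image is a multiple of the bond direction.\<close>
  then have "2 * sinh (\<sigma> * (lam + 2 * Em x i)) * Em ?v i
      - 2 * sinh (\<sigma> * (lam + 2 * Em_prev x i)) * Em_prev ?v i = ?s * ?v $ i" for i
    unfolding Em_bond[OF assms(4)] Em_prev_bond[OF assms(4)]
    by (cases "i = j"; cases "i = next_site j")
      (simp_all add: Em_prev_next_site[OF assms(4)] axis_def)
  then have "(\<chi> i. 2 * sinh (\<sigma> * (lam + 2 * Em x i)) * Em ?v i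
      - 2 * sinh (\<sigma> * (lam + 2 * Em_prev x i)) * Em_prev ?v i) = ?s *\<^sub>R ?v"
    by (simp add: vec_eq_iff)
  then have "bond_deriv j (f \<circ> ?g) x = ?f' (?s *\<^sub>R ?v)"
    using assms(1)
    by (subst bond_deriv_eq[OF has_derivative_compose_Xc[OF assms(5) has_derivative_g_map image]
          assms(3)]) auto
  also have "\<dots> = ?s * ?f' ?v"
    using linear_scale[OF has_derivative_linear[OF f']] by simp
  also have "?f' ?v = bond_deriv j f (?g x)"
    using bond_deriv_eq[OF f'] image assms(3) by (metis image_subset_iff)
  finally show ?thesis .
qed

lemma Ck_Xc_bond_deriv:
  assumes "Ck_Xc (Suc n) f"
  shows "Ck_Xc n (bond_deriv j f)"
proof -
  have "Ck_Xc n (\<lambda>x. pderiv_Xc j f x + (- 1) * pderiv_Xc (next_site j) f x)"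
    using assms by (intro Ck_Xc_add Ck_Xc_mult Ck_Xc_const) (auto simp: eta_contract_eq)
  then show ?thesis
    by (simp add: bond_deriv_def)
qed

text \<open>The first-order formula is differentiated again. The chain rule produces the squared
  factor, and the derivative of the scalar factor \<open>2 * sinh\<close> along the bond produces
  the first-order term.\<close>

lemma bond_deriv2_compose_g_map:
  assumes "\<sigma> > 0" "lam > 0" "x \<in> Xc" "j \<in> inner_sites" "Ck_Xc 2 f"
  shows "bond_deriv j (bond_deriv j (f \<circ> g_map \<sigma> lam)) x =
    4 * (sinh (\<sigma> * (lam + 2 * Em x j)))\<^sup>2 * bond_deriv j (bond_deriv j f) (g_map \<sigma> lam x)
    + 4 * \<sigma> * cosh (\<sigma> * (lam + 2 * Em x j)) * bond_deriv j f (g_map \<sigma> lam x)"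
proof -
  let ?g = "g_map \<sigma> lam" and ?l = "\<lambda>x. \<sigma> * (lam + 2 * Em x j)"
  have g: "?g x \<in> Xc" if "x \<in> Xc" for x
    using homeomorphism_g_map[OF assms(1,2)] homeomorphism_image1 that by blast
  have f: "f differentiable (at y within Xc)" if "y \<in> Xc" for y
    using assms(5) that by (auto simp: numeral_2_eq_2)
  have "Ck_Xc 1 (bond_deriv j f)"
    using assms(5) Ck_Xc_bond_deriv[of 1 f j] by (simp add: numeral_2_eq_2)
  then have f1: "bond_deriv j f differentiable (at y within Xc)" if "y \<in> Xc" for y
    using that by auto
  have s: "((\<lambda>x. 2 * sinh (?l x)) has_derivative (\<lambda>v. 2 * (2 * \<sigma> * cosh (?l x) * Em v j)))
      (at x within Xc)"
    by (intro has_derivative_mult_right has_derivative_cosh_Em)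
  have bs: "bond_deriv j (\<lambda>x. 2 * sinh (?l x)) x = 4 * \<sigma> * cosh (?l x)"
    using bond_deriv_eq[OF s assms(3), of j] assms(4) by (simp add: Em_bond)
  have "bond_deriv j f \<circ> ?g differentiable (at x within Xc)"
    using has_derivative_compose_Xc[OF f1[OF g[OF assms(3)]] has_derivative_g_map] g assms(1)
    by (auto intro: differentiableI)
  then have "bond_deriv j (\<lambda>x. 2 * sinh (?l x) * (bond_deriv j f \<circ> ?g) x) x =
      2 * sinh (?l x) * bond_deriv j (bond_deriv j f \<circ> ?g) x
      + 4 * \<sigma> * cosh (?l x) * (bond_deriv j f \<circ> ?g) x"
    using bond_deriv_mult[OF differentiableI[OF s] _ assms(3), of "bond_deriv j f \<circ> ?g" j]
    unfolding bs by blast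
  \<comment> \<open>The first-order formula is available only on \<open>Xc\<close>, which is enough
    for derivatives taken within \<open>Xc\<close>.\<close>
  moreover have "bond_deriv j (bond_deriv j (f \<circ> ?g)) x =
      bond_deriv j (\<lambda>x. 2 * sinh (?l x) * (bond_deriv j f \<circ> ?g) x) x"
    using bond_deriv_compose_g_map[OF assms(1,2) _ assms(4) f[OF g]] assms(3)
    by (intro bond_deriv_cong) simp_all
  ultimately show ?thesis
    using bond_deriv_compose_g_map[OF assms(1-4) f1[OF g[OF assms(3)]]]
    by (simp add: power2_eq_square)
qed

section \<open>Intertwining of the two generators\<close>

lemma cosh_diff_cosh:
  fixes p q :: real
  shows "cosh (p + q) - cosh (p - q) = 2 * sinh p * sinh q"
  by (simp add: cosh_add cosh_diff)

text \<open>Here \<open>lam + 2 * Em x j - x $ j\<close> is the midpoint of the two arguments of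
  cosh, and \<open>x $ j\<close> is half their distance. This is the origin of the shifted arguments
  in the ABEP coefficients.\<close>

lemma g_map_nth:
  "g_map \<sigma> lam x $ j = 2 * sinh (\<sigma> * (lam + 2 * Em x j - x $ j)) * sinh (\<sigma> * x $ j) / \<sigma>"
  using cosh_diff_cosh[of "\<sigma> * (lam + 2 * Em x j - x $ j)" "\<sigma> * x $ j"]
  by (simp add: g_map_def Em_eq_Em_prev_add algebra_simps)

lemma g_map_nth_next:
  assumes "j \<in> inner_sites"
  shows "g_map \<sigma> lam x $ next_site j =
    2 * sinh (\<sigma> * (lam + 2 * Em x j + x $ next_site j)) * sinh (\<sigma> * x $ next_site j) / \<sigma>"
  using Em_eq_Em_prev_add[of x "next_site j"] Em_prev_next_site[OF assms, of x]
  by (simp add: g_map_nth algebra_simps)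

text \<open>The sums agree bond by bond. With the product form of the components of
  \<open>g_map\<close>, the claim becomes a rational identity in the values of sinh and cosh and in
  the bond derivatives \<open>D1\<close>, \<open>D2\<close>.\<close>

lemma L_BEP_g_map:
  assumes "\<sigma> > 0" "lam > 0" "x \<in> Xc" "Ck_Xc 2 f"
  shows "L_BEP k f (g_map \<sigma> lam x) = L_ABEP \<sigma> k lam (f \<circ> g_map \<sigma> lam) x"
  unfolding L_BEP_def L_ABEP_def
proof (rule sum.cong[OF refl])
  fix j :: 'a assume j: "j \<in> inner_sites"
  let ?g = "g_map \<sigma> lam"
  define S where "S = sinh (\<sigma> * (lam + 2 * Em x j))"
  define C where "C = cosh (\<sigma> * (lam + 2 * Em x j))"
  define a where "a = sinh (\<sigma> * x $ j)"
  define b where "b = sinh (\<sigma> * x $ next_site j)"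
  define p where "p = sinh (\<sigma> * (lam + 2 * Em x j - x $ j))"
  define q where "q = sinh (\<sigma> * (lam + 2 * Em x j + x $ next_site j))"
  define D1 where "D1 = bond_deriv j f (?g x)"
  define D2 where "D2 = bond_deriv j (bond_deriv j f) (?g x)"
  \<comment> \<open>The argument of sinh is positive because \<open>lam > 0\<close> and partial sums
    are nonnegative; this permits division by \<open>S\<close>.\<close>
  have S: "S \<noteq> 0"
    using assms(1,2) Em_nonneg[OF assms(3), of j] by (simp add: S_def)
  have "?g x \<in> Xc"
    using homeomorphism_g_map[OF assms(1,2)] homeomorphism_image1 assms(3) by blast
  then have "f differentiable (at (?g x) within Xc)"
    using assms(4) by (auto simp: numeral_2_eq_2)
  then have d1: "bond_deriv j (f \<circ> ?g) x = 2 * S * D1"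
    using bond_deriv_compose_g_map assms j by (simp add: S_def D1_def)
  have d2: "bond_deriv j (bond_deriv j (f \<circ> ?g)) x = 4 * S\<^sup>2 * D2 + 4 * \<sigma> * C * D1"
    using bond_deriv2_compose_g_map assms j by (simp add: S_def C_def D1_def D2_def)
  have A: "ABEP_A \<sigma> lam j x = 1 / \<sigma>\<^sup>2 * a * b * (p * q / S\<^sup>2)"
    by (simp add: ABEP_A_def Let_def S_def a_def b_def p_def q_def)
  have B: "ABEP_B \<sigma> k lam j x = 1 / \<sigma> * (k j * b * (q / S) - k (next_site j) * a * (p / S)
      - 2 * a * b * (C * p * q / S ^ 3))"
    by (simp add: ABEP_B_def Let_def S_def C_def a_def b_def p_def q_def)
  have g: "?g x $ j = 2 * p * a / \<sigma>" "?g x $ next_site j = 2 * q * b / \<sigma>"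
    by (simp_all add: g_map_nth_next j p_def q_def a_def b_def) (simp add: g_map_nth)
  show "?g x $ j * ?g x $ next_site j * bond_deriv j (bond_deriv j f) (?g x)
        + (k j * ?g x $ next_site j - k (next_site j) * ?g x $ j) * bond_deriv j f (?g x)
      = ABEP_A \<sigma> lam j x * bond_deriv j (bond_deriv j (f \<circ> ?g)) x
        + ABEP_B \<sigma> k lam j x * bond_deriv j (f \<circ> ?g) x"
  proof -
    \<comment> \<open>The second-order part of ABEP leaves an extra multiple of \<open>D1\<close>.
      It is exactly what the last term of \<open>ABEP_B\<close> removes in the next
      identity.\<close>
    have "1 / \<sigma>\<^sup>2 * a * b * (p * q / S\<^sup>2) * (4 * S\<^sup>2 * D2 + 4 * \<sigma> * C * D1)
        = 2 * p * a / \<sigma> * (2 * q * b / \<sigma>) * D2 + 4 * a * b * p * q * C / (\<sigma> * S\<^sup>2) * D1"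
      using S assms(1) by (simp add: distrib_left power2_eq_square mult_ac)
    moreover have "1 / \<sigma> * (k j * b * (q / S) - k (next_site j) * a * (p / S)
          - 2 * a * b * (C * p * q / S ^ 3)) * (2 * S * D1)
        = (k j * (2 * q * b / \<sigma>) - k (next_site j) * (2 * p * a / \<sigma>)) * D1
          - 4 * a * b * p * q * C / (\<sigma> * S\<^sup>2) * D1"
      using S assms(1) by (simp add: left_diff_distrib right_diff_distrib power2_eq_square power3_eq_cube mult_ac)
    ultimately show ?thesis
      unfolding d1 d2 A B g D1_def[symmetric] D2_def[symmetric] by linarith
  qed
qed

section \<open>Transport of diffusions along homeomorphisms\<close>

text \<open>A homeomorphism of the closed orthant is proper: points sent into a ball lie in the
  image under \<open>h\<close> of a compact set, which is bounded.\<close>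

lemma filterlim_homeomorphism_Xc:
  fixes g :: "'m::finite config \<Rightarrow> 'n::finite config"
  assumes "homeomorphism Xc Xc g h"
  shows "filterlim g (inf at_infinity (principal Xc)) (inf at_infinity (principal Xc))"
  unfolding filterlim_iff eventually_inf_principal eventually_at_infinity
proof (intro allI impI)
  fix P :: "'n config \<Rightarrow> bool"
  assume "\<exists>b. \<forall>x. b \<le> norm x \<longrightarrow> x \<in> Xc \<longrightarrow> P x"
  then obtain b where b: "\<And>x. b \<le> norm x \<Longrightarrow> x \<in> Xc \<Longrightarrow> P x" by auto
  have "compact (h ` (Xc \<inter> cball 0 b))"
    using homeomorphism_cont2[OF assms] closed_Xc
    by (intro compact_continuous_image) (auto intro: continuous_on_subset closed_Int_compact)
  then obtain B where B: "\<And>x. x \<in> h ` (Xc \<inter> cball 0 b) \<Longrightarrow> norm x \<le> B"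
    by (meson bounded_iff compact_imp_bounded)
  have "P (g x)" if "B + 1 \<le> norm x" "x \<in> Xc" for x
  proof (rule b)
    show "g x \<in> Xc"
      using assms that homeomorphism_image1 by blast
    show "b \<le> norm (g x)"
    proof (rule ccontr)
      assume "\<not> b \<le> norm (g x)"
      then have "h (g x) \<in> h ` (Xc \<inter> cball 0 b)"
        using \<open>g x \<in> Xc\<close> by auto
      then show False
        using B[of x] that homeomorphism_apply1[OF assms] by auto
    qed
  qed
  then show "\<exists>b. \<forall>x. b \<le> norm x \<longrightarrow> x \<in> Xc \<longrightarrow> P (g x)" by blast
qed

lemma C0_Xc_compose:
  fixes g h :: "'m::finite config \<Rightarrow> 'm config"
  assumes "homeomorphism Xc Xc g h" "C0_Xc f"
  shows "C0_Xc (\<lambda>x. f (g x))"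
proof -
  have "continuous_on Xc (\<lambda>x. f (g x))"
    using assms(2) homeomorphism_cont1[OF assms(1)] homeomorphism_image1[OF assms(1)]
    by (intro continuous_on_compose2[of Xc f Xc g]) (auto simp: C0_Xc_def)
  then show ?thesis
    using assms(2) filterlim_compose[OF _ filterlim_homeomorphism_Xc[OF assms(1)]]
    by (auto simp: C0_Xc_def)
qed

lemma C0_Xc_cong:
  assumes "\<And>x. x \<in> Xc \<Longrightarrow> f x = h x"
  shows "C0_Xc f \<longleftrightarrow> C0_Xc h"
proof -
  have "eventually (\<lambda>x. f x = h x) (inf at_infinity (principal Xc))"
    using assms by (auto simp: eventually_inf_principal)
  then show ?thesis
    unfolding C0_Xc_def using assms continuous_on_cong[OF refl, of Xc f h] tendsto_cong by blast
qed

lemma space_state_space: "space state_space = Xc"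
  by (simp add: space_restrict_space)

lemma measurable_homeomorphism_Xc:
  fixes g h :: "'m::finite config \<Rightarrow> 'm config"
  assumes "homeomorphism Xc Xc g h"
  shows "g \<in> state_space \<rightarrow>\<^sub>M state_space"
  using homeomorphism_image1[OF assms]
  by (intro measurable_restrict_space2 borel_measurable_continuous_on_restrict
      homeomorphism_cont1[OF assms]) (auto simp: space_state_space)

text \<open>The support of the composition is contained in the image under \<open>h\<close> of the
  support of \<open>f\<close>. Closedness of \<open>Xc\<close> keeps that support inside the set
  where \<open>h\<close> is continuous.\<close>

lemma compact_support_compose:
  fixes f :: "'m::finite config \<Rightarrow> real" and g h :: "'m config \<Rightarrow> 'm config"
  assumes "homeomorphism Xc Xc g h" "compact (closure {x\<in>Xc. f x \<noteq> 0})"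
  shows "compact (closure {x\<in>Xc. f (g x) \<noteq> 0})"
proof -
  let ?K = "closure {x\<in>Xc. f x \<noteq> 0}"
  have "?K \<subseteq> Xc"
    using closed_Xc by (intro closure_minimal) auto
  then have "compact (h ` ?K)"
    using assms(2) homeomorphism_cont2[OF assms(1)]
    by (intro compact_continuous_image) (auto intro: continuous_on_subset)
  moreover have "{x\<in>Xc. f (g x) \<noteq> 0} \<subseteq> h ` ?K"
  proof
    fix x assume x: "x \<in> {x\<in>Xc. f (g x) \<noteq> 0}"
    then have "g x \<in> Xc" "h (g x) = x"
      using homeomorphism_image1[OF assms(1)] homeomorphism_apply1[OF assms(1)] by auto
    then show "x \<in> h ` ?K"
      using x closure_subset[of "{x\<in>Xc. f x \<noteq> 0}"] by (intro image_eqI[of _ _ "g x"]) auto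
  qed
  ultimately show ?thesis
    by (meson bounded_closure bounded_subset closed_closure compact_eq_bounded_closed)
qed

section \<open>Push-forward of Feller semigroups and generators\<close>

text \<open>The transition kernel of the image under \<open>g\<close> of a Markov process with
  kernels \<open>P\<close>: start at \<open>h y\<close>, run for time \<open>t\<close>, apply
  \<open>g\<close>.\<close>

definition push_kernel ::
  "('m::finite config \<Rightarrow> 'm config) \<Rightarrow> ('m config \<Rightarrow> 'm config) \<Rightarrow>
   (real \<Rightarrow> 'm config \<Rightarrow> 'm config measure) \<Rightarrow> real \<Rightarrow> 'm config \<Rightarrow> 'm config measure" where
  "push_kernel g h P t y = distr (P t (h y)) state_space g"

lemma feller_semigroup_kernel:
  assumes "feller_semigroup P" "t \<ge> 0" "x \<in> Xc"
  shows "sets (P t x) = sets state_space" "prob_space (P t x)" "space (P t x) = Xc"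
proof -
  have "P t \<in> state_space \<rightarrow>\<^sub>M prob_algebra state_space"
    using assms by (simp add: feller_semigroup_def)
  from measurable_space[OF this, of x] have "P t x \<in> space (prob_algebra state_space)"
    using assms(3) by (simp add: space_state_space)
  then show "sets (P t x) = sets state_space" "prob_space (P t x)"
    by (auto simp: space_prob_algebra)
  then show "space (P t x) = Xc"
    using sets_eq_imp_space_eq space_state_space by metis
qed

lemma measurable_feller_kernel:
  assumes "feller_semigroup P" "t \<ge> 0" "x \<in> Xc"
  shows "measurable (P t x) N = measurable state_space N"
  using feller_semigroup_kernel(1)[OF assms] by (rule measurable_cong_sets) simp

lemma integral_push_kernel:
  fixes f :: "'m::finite config \<Rightarrow> real" and g h :: "'m config \<Rightarrow> 'm config"
  assumes "homeomorphism Xc Xc g h" "feller_semigroup P" "t \<ge> 0" "y \<in> Xc" "C0_Xc f"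
  shows "(\<integral>z. f z \<partial>push_kernel g h P t y) = (\<integral>x. f (g x) \<partial>P t (h y))"
proof -
  have "h y \<in> Xc"
    using assms(4) homeomorphism_image2[OF assms(1)] by blast
  moreover have "f \<in> borel_measurable state_space"
    using assms(5) by (auto simp: C0_Xc_def intro: borel_measurable_continuous_on_restrict)
  ultimately show ?thesis
    unfolding push_kernel_def using measurable_homeomorphism_Xc[OF assms(1)]
    by (intro integral_distr) (simp_all add: measurable_feller_kernel assms)
qed

lemma feller_semigroup_push_kernel:
  fixes g h :: "'m::finite config \<Rightarrow> 'm config"
  assumes hom: "homeomorphism Xc Xc g h" and P: "feller_semigroup P"
  shows "feller_semigroup (push_kernel g h P)"
proof -
  note hom' = homeomorphism_symD[OF hom]
  note mg = measurable_homeomorphism_Xc[OF hom]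
  note mh = measurable_homeomorphism_Xc[OF hom']
  have hX: "h y \<in> Xc" if "y \<in> Xc" for y
    using that homeomorphism_image2[OF hom] by blast
  have PM: "P t \<in> state_space \<rightarrow>\<^sub>M prob_algebra state_space" if "t \<ge> 0" for t
    using P that by (auto simp: feller_semigroup_def)
  have QM: "push_kernel g h P t \<in> state_space \<rightarrow>\<^sub>M prob_algebra state_space" if "t \<ge> 0" for t
    unfolding push_kernel_def
    using measurable_compose[OF measurable_compose[OF mh PM[OF that]] measurable_distr_prob_space[OF mg]] .
  have start: "push_kernel g h P 0 y = return state_space y" if "y \<in> Xc" for y
  proof -
    have "push_kernel g h P 0 y = distr (return state_space (h y)) state_space g"
      using P hX[OF that] by (auto simp: push_kernel_def feller_semigroup_def)
    also have "\<dots> = return state_space (g (h y))"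
      using mg hX[OF that] by (intro distr_return) (auto simp: space_state_space)
    finally show ?thesis
      using homeomorphism_apply2[OF hom that] by simp
  qed
  have semigroup: "push_kernel g h P (s + t) y = bind (push_kernel g h P s y) (push_kernel g h P t)"
    if st: "s \<ge> 0" "t \<ge> 0" and y: "y \<in> Xc" for s t y
  proof -
    note K = feller_semigroup_kernel[OF P st(1) hX[OF y]]
    have ne: "space (P s (h y)) \<noteq> {}"
      using K zero_mem_Xc by auto
    have gM: "g \<in> P s (h y) \<rightarrow>\<^sub>M state_space"
      using mg by (simp add: measurable_feller_kernel[OF P st(1) hX[OF y]])
    have "push_kernel g h P (s + t) y = distr (bind (P s (h y)) (P t)) state_space g"
      using P st hX[OF y] by (auto simp: push_kernel_def feller_semigroup_def)
    also have "\<dots> = bind (P s (h y)) (\<lambda>x. distr (P t x) state_space g)"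
      using measurable_prob_algebraD[OF PM[OF st(2)]] ne mg
      by (intro distr_bind) (auto simp: measurable_feller_kernel[OF P st(1) hX[OF y]])
    \<comment> \<open>Inserting \<open>h (g x) = x\<close> makes the inner kernel a function of
      \<open>g x\<close>, so that the outer measure can be replaced by its image under
      \<open>g\<close>.\<close>
    also have "\<dots> = bind (P s (h y)) (\<lambda>x. push_kernel g h P t (g x))"
      using K homeomorphism_apply1[OF hom] by (intro bind_cong) (auto simp: push_kernel_def)
    also have "\<dots> = bind (distr (P s (h y)) state_space g) (push_kernel g h P t)"
      using bind_distr[OF gM measurable_prob_algebraD[OF QM[OF st(2)]] ne] by simp
    finally show ?thesis
      by (simp add: push_kernel_def)
  qed
  have c0: "C0_Xc (\<lambda>y. \<integral>z. f z \<partial>push_kernel g h P t y)" if "C0_Xc f" "t \<ge> 0" for f t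
  proof -
    have "C0_Xc (\<lambda>x. \<integral>z. f (g z) \<partial>P t x)"
      using P C0_Xc_compose[OF hom that(1)] that(2) by (auto simp: feller_semigroup_def)
    from C0_Xc_compose[OF hom' this] show ?thesis
      using integral_push_kernel[OF hom P that(2) _ that(1)] by (subst C0_Xc_cong) auto
  qed
  have lim: "uniform_limit Xc (\<lambda>t y. \<integral>z. f z \<partial>push_kernel g h P t y) f (at_right 0)"
    if f: "C0_Xc f" for f
  proof -
    have "uniform_limit Xc (\<lambda>t x. \<integral>z. f (g z) \<partial>P t x) (\<lambda>x. f (g x)) (at_right 0)"
      using P C0_Xc_compose[OF hom f] by (auto simp: feller_semigroup_def)
    \<comment> \<open>Uniform convergence on \<open>Xc\<close> survives the substitution of
      \<open>h y\<close> for \<open>x\<close>, since \<open>h\<close> maps \<open>Xc\<close> into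
      itself; \<open>g (h y) = y\<close> then restores \<open>f\<close>.\<close>
    then have "uniform_limit Xc (\<lambda>t y. \<integral>z. f (g z) \<partial>P t (h y)) (\<lambda>y. f (g (h y))) (at_right 0)"
      by (rule uniform_limit_compose'[where h = h]) (use hX in auto)
    then show ?thesis
    proof (rule uniform_limit_cong[THEN iffD1, rotated 2])
      show "\<forall>\<^sub>F t in at_right 0. \<forall>y\<in>Xc. (\<integral>z. f (g z) \<partial>P t (h y)) = (\<integral>z. f z \<partial>push_kernel g h P t y)"
        using integral_push_kernel[OF hom P _ _ f]
        by (auto simp: eventually_at_right_less intro!: eventually_at_rightI[of 0 1])
    qed (simp add: homeomorphism_apply2[OF hom])
  qed
  show ?thesis
    unfolding feller_semigroup_def using QM start semigroup c0 lim by blast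
qed

text \<open>The difference quotient of \<open>f\<close> at \<open>y\<close> for the pushed semigroup
  equals that of \<open>f \<circ> g\<close> at \<open>h y\<close> for \<open>P\<close>, so the
  uniform limits correspond under \<open>h\<close>.\<close>

lemma inf_generator_push_kernel:
  fixes g h :: "'m::finite config \<Rightarrow> 'm config"
  assumes hom: "homeomorphism Xc Xc g h" and P: "feller_semigroup P"
    and f: "C0_Xc f" and gen: "inf_generator P (f \<circ> g) u"
    and u: "\<And>x. x \<in> Xc \<Longrightarrow> v (g x) = u x"
  shows "inf_generator (push_kernel g h P) f v"
proof -
  note hom' = homeomorphism_symD[OF hom]
  have hX: "h y \<in> Xc" if "y \<in> Xc" for y
    using that homeomorphism_image2[OF hom] by blast
  have v: "v y = u (h y)" if "y \<in> Xc" for y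
    using u[OF hX[OF that]] homeomorphism_apply2[OF hom that] by simp
  have "C0_Xc u"
    using gen by (simp add: inf_generator_def)
  from C0_Xc_compose[OF hom' this] have "C0_Xc v"
    using v by (subst C0_Xc_cong) auto
  moreover have "uniform_limit Xc (\<lambda>t y. ((\<integral>z. f z \<partial>push_kernel g h P t y) - f y) / t) v (at_right 0)"
  proof -
    have "uniform_limit Xc (\<lambda>t x. ((\<integral>z. f (g z) \<partial>P t x) - f (g x)) / t) u (at_right 0)"
      using gen by (simp add: inf_generator_def)
    then have "uniform_limit Xc (\<lambda>t y. ((\<integral>z. f (g z) \<partial>P t (h y)) - f (g (h y))) / t)
        (\<lambda>y. u (h y)) (at_right 0)"
      by (rule uniform_limit_compose'[where h = h]) (use hX in auto)
    then show ?thesis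
    proof (rule uniform_limit_cong[THEN iffD1, rotated 2])
      show "\<forall>\<^sub>F t in at_right 0. \<forall>y\<in>Xc. ((\<integral>z. f (g z) \<partial>P t (h y)) - f (g (h y))) / t
          = ((\<integral>z. f z \<partial>push_kernel g h P t y) - f y) / t"
        using integral_push_kernel[OF hom P _ _ f] homeomorphism_apply2[OF hom]
        by (auto intro!: eventually_at_rightI[of 0 1])
    qed (simp add: v)
  qed
  ultimately show ?thesis
    using f by (simp add: inf_generator_def)
qed

lemma C0_Xc_if_compact_support:
  assumes "continuous_on Xc f" "compact (closure {x\<in>Xc. f x \<noteq> 0})"
  shows "C0_Xc f"
proof -
  obtain B where B: "\<And>x. x \<in> closure {x\<in>Xc. f x \<noteq> 0} \<Longrightarrow> norm x \<le> B"
    using compact_imp_bounded[OF assms(2)] by (auto simp: bounded_iff)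
  have "f x = 0" if "B + 1 \<le> norm x" "x \<in> Xc" for x
    using that B[of x] closure_subset[of "{x\<in>Xc. f x \<noteq> 0}"] by auto
  then have "eventually (\<lambda>x. f x = 0) (inf at_infinity (principal Xc))"
    unfolding eventually_inf_principal eventually_at_infinity by blast
  then show ?thesis
    using assms(1) tendsto_eventually by (auto simp: C0_Xc_def)
qed

section \<open>Filtrations and the Markov property of the image process\<close>

text \<open>Each process is a measurable image of the other, via \<open>g\<close> and via
  \<open>h\<close>, so the two families of generating events coincide.\<close>

lemma natural_filtration_compose:
  fixes g h :: "'m::finite config \<Rightarrow> 'm config"
  assumes hom: "homeomorphism Xc Xc g h"
    and X: "\<And>t. t \<ge> 0 \<Longrightarrow> X t \<in> W \<rightarrow>\<^sub>M state_space"
  shows "natural_filtration W (\<lambda>t \<omega>. g (X t \<omega>)) t = natural_filtration W X t"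
proof -
  have XX: "X s \<omega> \<in> Xc" if "s \<ge> 0" "\<omega> \<in> space W" for s \<omega>
    using measurable_space[OF X[OF that(1)] that(2)] by (simp add: space_state_space)
  \<comment> \<open>Used twice: with \<open>a = g\<close> on the original process, and with
    \<open>a = h\<close> on its image.\<close>
  have sub: "{(\<lambda>\<omega>. a (Y s \<omega>)) -` A \<inter> space W |s A. 0 \<le> s \<and> s \<le> t \<and> A \<in> sets state_space}
      \<subseteq> {Y s -` A \<inter> space W |s A. 0 \<le> s \<and> s \<le> t \<and> A \<in> sets state_space}"
    if a: "a \<in> state_space \<rightarrow>\<^sub>M state_space" and Y: "\<And>s \<omega>. s \<ge> 0 \<Longrightarrow> \<omega> \<in> space W \<Longrightarrow> Y s \<omega> \<in> Xc"
    for a :: "'m config \<Rightarrow> 'm config" and Y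
  proof clarify
    fix s and A :: "'m config set" assume s: "0 \<le> s" "s \<le> t" and A: "A \<in> sets state_space"
    \<comment> \<open>Intersecting with \<open>Xc\<close> is harmless because the process stays
      there, and it gives a set whose measurability follows from that of \<open>a\<close>.\<close>
    have "(\<lambda>\<omega>. a (Y s \<omega>)) -` A \<inter> space W = Y s -` (a -` A \<inter> Xc) \<inter> space W"
      using Y[OF s(1)] by auto
    moreover have "a -` A \<inter> Xc \<in> sets state_space"
      using measurable_sets[OF a A] by (simp add: space_state_space)
    ultimately show "\<exists>s' A'. (\<lambda>\<omega>. a (Y s \<omega>)) -` A \<inter> space W = Y s' -` A' \<inter> space W
        \<and> 0 \<le> s' \<and> s' \<le> t \<and> A' \<in> sets state_space"
      using s by blast
  qed
  have gX: "g (X s \<omega>) \<in> Xc" if "s \<ge> 0" "\<omega> \<in> space W" for s \<omega>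
    using XX[OF that] homeomorphism_image1[OF hom] by blast
  have eq: "X s -` A \<inter> space W = (\<lambda>\<omega>. h (g (X s \<omega>))) -` A \<inter> space W" if "s \<ge> 0" for s A
    using XX[OF that] homeomorphism_apply1[OF hom] by auto
  have "{X s -` A \<inter> space W |s A. 0 \<le> s \<and> s \<le> t \<and> A \<in> sets state_space}
      = {(\<lambda>\<omega>. h (g (X s \<omega>))) -` A \<inter> space W |s A. 0 \<le> s \<and> s \<le> t \<and> A \<in> sets state_space}"
    by (intro Collect_cong iff_exI) (metis eq)
  also have "\<dots> \<subseteq> {(\<lambda>\<omega>. g (X s \<omega>)) -` A \<inter> space W |s A. 0 \<le> s \<and> s \<le> t \<and> A \<in> sets state_space}"
    using sub[OF measurable_homeomorphism_Xc[OF homeomorphism_symD[OF hom]], of "\<lambda>s \<omega>. g (X s \<omega>)"] gX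
    by blast
  finally show ?thesis
    using sub[OF measurable_homeomorphism_Xc[OF hom], of X] XX
    unfolding natural_filtration_def by (metis (no_types, lifting) subset_antisym)
qed

lemma subalgebra_natural_filtration:
  assumes "\<And>t. t \<ge> 0 \<Longrightarrow> X t \<in> W \<rightarrow>\<^sub>M state_space"
  shows "subalgebra W (natural_filtration W X s)"
proof -
  let ?G = "{X r -` A \<inter> space W |r A. 0 \<le> r \<and> r \<le> s \<and> A \<in> sets state_space}"
  have "?G \<subseteq> sets W"
    using assms by (auto dest: measurable_sets)
  moreover have "?G \<subseteq> Pow (space W)" by auto
  ultimately show ?thesis
    unfolding subalgebra_def natural_filtration_def
    by (simp only: space_measure_of sets_measure_of sets.sigma_sets_subset simp_thms)
qed

text \<open>The image process has the pushed semigroup. A test function \<open>f\<close> for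
  \<open>L'\<close> is pulled back to \<open>f \<circ> g\<close>, again C^3 with compact support,
  and the intertwining identifies the generators.\<close>

lemma diffusion_with_generator_homeomorphism:
  fixes g h :: "'m::finite config \<Rightarrow> 'm config"
  assumes hom: "homeomorphism Xc Xc g h"
    and smooth: "\<And>f. Ck_Xc 3 f \<Longrightarrow> Ck_Xc 3 (f \<circ> g)"
    and L: "\<And>f x. Ck_Xc 3 f \<Longrightarrow> x \<in> Xc \<Longrightarrow> L' f (g x) = L (f \<circ> g) x"
    and X: "diffusion_with_generator L W X"
  shows "diffusion_with_generator L' W (\<lambda>t \<omega>. g (X t \<omega>))"
proof -
  from X obtain P where P: "feller_semigroup P"
    and gen: "\<And>f. Ck_Xc 3 f \<Longrightarrow> compact (closure {x\<in>Xc. f x \<noteq> 0}) \<Longrightarrow> inf_generator P f (L f)"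
    and markov: "\<And>s t A. s \<ge> 0 \<Longrightarrow> t \<ge> 0 \<Longrightarrow> A \<in> sets state_space \<Longrightarrow>
         AE \<omega> in W. real_cond_exp W (natural_filtration W X s)
            (\<lambda>\<omega>'. indicator A (X (s + t) \<omega>')) \<omega> = measure (P t (X s \<omega>)) A"
    unfolding diffusion_with_generator_def by blast
  have W: "prob_space W" and XM: "\<And>t. t \<ge> 0 \<Longrightarrow> X t \<in> W \<rightarrow>\<^sub>M state_space"
    and cont: "\<And>\<omega>. \<omega> \<in> space W \<Longrightarrow> continuous_on {0..} (\<lambda>t. X t \<omega>)"
    using X unfolding diffusion_with_generator_def by blast+
  note mg = measurable_homeomorphism_Xc[OF hom]
  have XX: "X s \<omega> \<in> Xc" if "s \<ge> 0" "\<omega> \<in> space W" for s \<omega>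
    using measurable_space[OF XM[OF that(1)] that(2)] by (simp add: space_state_space)
  have "continuous_on {0..} (\<lambda>t. g (X t \<omega>))" if "\<omega> \<in> space W" for \<omega>
    using XX that
    by (intro continuous_on_compose2[OF homeomorphism_cont1[OF hom] cont[OF that]]) auto
  moreover have "inf_generator (push_kernel g h P) f (L' f)"
    if f: "Ck_Xc 3 f" "compact (closure {x\<in>Xc. f x \<noteq> 0})" for f
  proof (rule inf_generator_push_kernel[OF hom P])
    show "C0_Xc f"
      using f Ck_Xc_continuous by (intro C0_Xc_if_compact_support)
    show "inf_generator P (f \<circ> g) (L (f \<circ> g))"
      using gen[OF smooth[OF f(1)]] compact_support_compose[OF hom f(2)] by simp
  qed (rule L[OF f(1)])
  moreover have "AE \<omega> in W. real_cond_exp W (natural_filtration W (\<lambda>t \<omega>. g (X t \<omega>)) s)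
        (\<lambda>\<omega>'. indicator A (g (X (s + t) \<omega>'))) \<omega> = measure (push_kernel g h P t (g (X s \<omega>))) A"
    if st: "s \<ge> 0" "t \<ge> 0" and A: "A \<in> sets state_space" for s t A
  proof -
    let ?B = "g -` A \<inter> Xc" and ?F = "natural_filtration W X s"
    have B: "?B \<in> sets state_space"
      using measurable_sets[OF mg A] by (simp add: space_state_space)
    interpret prob_space W by (rule W)
    interpret finite_measure_subalgebra W ?F
      by unfold_locales (rule subalgebra_natural_filtration[OF XM])
    have [measurable]: "X (s + t) \<in> W \<rightarrow>\<^sub>M state_space" "g \<in> state_space \<rightarrow>\<^sub>M state_space"
      using XM st mg by auto
    note [measurable] = A B
    \<comment> \<open>The event that the image process lies in \<open>A\<close> is the event that
      \<open>X\<close> lies in the preimage \<open>?B\<close>, so the Markov property of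
      \<open>X\<close> applies to \<open>?B\<close>.\<close>
    have cond: "AE \<omega> in W. real_cond_exp W ?F (\<lambda>\<omega>'. indicator A (g (X (s + t) \<omega>'))) \<omega>
        = real_cond_exp W ?F (\<lambda>\<omega>'. indicator ?B (X (s + t) \<omega>')) \<omega>"
    proof (rule real_cond_exp_cong)
      show "AE \<omega> in W. indicator A (g (X (s + t) \<omega>)) = (indicator ?B (X (s + t) \<omega>) :: real)"
        using XX[of "s + t"] st by (intro AE_I2) (auto simp: indicator_def)
    qed measurable
    \<comment> \<open>Since \<open>h (g (X s \<omega>)) = X s \<omega>\<close>, the pushed kernel at
      the image point is the image under \<open>g\<close> of the original kernel at
      \<open>X s \<omega>\<close>.\<close>
    have kernel: "measure (push_kernel g h P t (g (X s \<omega>))) A = measure (P t (X s \<omega>)) ?B"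
      if "\<omega> \<in> space W" for \<omega>
    proof -
      note x = XX[OF st(1) that]
      show ?thesis
        unfolding push_kernel_def homeomorphism_apply1[OF hom x]
        using measure_distr[of g "P t (X s \<omega>)" state_space A] mg A
        by (simp add: measurable_feller_kernel[OF P st(2) x] feller_semigroup_kernel(3)[OF P st(2) x])
    qed
    have filtration: "natural_filtration W (\<lambda>t \<omega>. g (X t \<omega>)) s = ?F"
      using XM by (intro natural_filtration_compose[OF hom])
    from cond markov[OF st B] AE_space show ?thesis
      unfolding filtration by eventually_elim (simp add: kernel)
  qed
  moreover have "(\<lambda>\<omega>. g (X t \<omega>)) \<in> W \<rightarrow>\<^sub>M state_space" if "t \<ge> 0" for t
    using measurable_compose[OF XM[OF that] mg] .
  ultimately show ?thesis
    unfolding diffusion_with_generator_def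
    using W feller_semigroup_push_kernel[OF hom P] by blast
qed

theorem theorem4p8:
  fixes \<sigma> lam :: real and k :: "'m::{finite,linorder} \<Rightarrow> real"
  assumes "\<sigma> > 0" and "lam > 0" and "\<And>j. k j > 0"
  shows "g_map \<sigma> lam ` (Xc :: 'm config set) \<subseteq> Xc
    \<and> (\<forall>f :: 'm config \<Rightarrow> real. Ck_Xc 3 f \<longrightarrow>
         (\<forall>x\<in>Xc. L_BEP k f (g_map \<sigma> lam x) = L_ABEP \<sigma> k lam (f \<circ> g_map \<sigma> lam) x))
    \<and> (\<forall>(W :: 'w measure) (X :: real \<Rightarrow> 'w \<Rightarrow> 'm config). \<forall>x\<in>Xc.
         diffusion_with_generator (L_ABEP \<sigma> k lam) W X \<and> (AE \<omega> in W. X 0 \<omega> = x) \<longrightarrow>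
         diffusion_with_generator (L_BEP k) W (\<lambda>t \<omega>. g_map \<sigma> lam (X t \<omega>)) \<and>
         (AE \<omega> in W. g_map \<sigma> lam (X 0 \<omega>) = g_map \<sigma> lam x))"
proof -
  let ?g = "g_map \<sigma> lam :: 'm config \<Rightarrow> 'm config"
  note hom = homeomorphism_g_map[OF assms(1,2), where 'a = 'm]
  have image: "?g ` Xc \<subseteq> Xc"
    using homeomorphism_image1[OF hom] by simp
  have L: "L_BEP k f (?g x) = L_ABEP \<sigma> k lam (f \<circ> ?g) x" if "Ck_Xc 3 f" "x \<in> Xc" for f x
    using that assms(1,2) Ck_Xc_mono[of 2 3 f] by (intro L_BEP_g_map) auto
  have smooth: "Ck_Xc 3 (f \<circ> ?g)" if "Ck_Xc 3 f" for f
    using that Ck_Xc_g_map image by (rule Ck_Xc_compose)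
  have "diffusion_with_generator (L_BEP k) W (\<lambda>t \<omega>. ?g (X t \<omega>))"
    if "diffusion_with_generator (L_ABEP \<sigma> k lam) W X" for W :: "'w measure" and X
    using hom smooth L that by (rule diffusion_with_generator_homeomorphism)
  \<comment> \<open>The initial condition carries over by applying \<open>g_map\<close> on the
    almost sure event where \<open>X 0 \<omega> = x\<close>.\<close>
  then show ?thesis
    using image L by auto
qed

end
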